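(* Let $n\ge 0$ be an integer. Then $E_n(1,x)$ is a complete permutation polynomial over $\mathbb{Z}_3$ if and only if $n\equiv 3\pmod{24}$ or $n\equiv 15\pmod{24}$.
   Context: The $n$th reversed Dickson polynomial of the second kind (with parameter $1$) is the integer-coefficient polynomial $E_n(1,x)=\sum_{i=0}^{\lfloor n/2\rfloor}\binom{n-i}{i}(-x)^i$; equivalently $E_0(1,x)=1$, $E_1(1,x)=1$, $E_n(1,x)=E_{n-1}(1,x)-x\,E_{n-2}(1,x)$ for $n\ge 2$. A polynomial $f$ is a permutation polynomial over $\mathbb{Z}_3=\mathbb{F}_3$ if the map it induces $\mathbb{Z}_3\to\mathbb{Z}_3$ is a bijection, and a complete permutation polynomial if both $f(x)$ and $f(x)+x$ are permutation polynomials over $\mathbb{Z}_3$. *)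

theory Defs
  imports
    "HOL-Computational_Algebra.Polynomial"
    "HOL-Library.Numeral_Type"
    "HOL-Number_Theory.Cong"
begin

(* E_n(1,x): the parameter is fixed to 1 and [:0, 1:] is the indeterminate x. *)

definition rev_dickson2 :: "nat \<Rightarrow> int poly" where
  "rev_dickson2 n = (\<Sum>i\<le>n div 2. of_nat ((n - i) choose i) * (- [:0, 1:]) ^ i)"

definition permutation_poly :: "'a::{finite,comm_ring_1} poly \<Rightarrow> bool" where
  "permutation_poly f \<longleftrightarrow> bij (poly f)"

definition complete_permutation_poly :: "'a::{finite,comm_ring_1} poly \<Rightarrow> bool" where
  "complete_permutation_poly f \<longleftrightarrow> permutation_poly f \<and> permutation_poly (f + [:0, 1:])"

(* The numeral type 3 with its comm_ring_1 structure is the ring of integers modulo 3;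
   an integer polynomial is viewed over it by reducing its coefficients. *)

definition reduce_mod3 :: "int poly \<Rightarrow> 3 poly" where
  "reduce_mod3 f = map_poly of_int f"

lemma rev_dickson2_recurrence:
  "rev_dickson2 0 = 1"
  "rev_dickson2 1 = 1"
  "rev_dickson2 (n + 2) = rev_dickson2 (n + 1) - [:0, 1:] * rev_dickson2 n"
proof -
  have ext: "rev_dickson2 m = (\<Sum>i\<le>m. of_nat ((m - i) choose i) * (- [:0, 1:]) ^ i)" for m
    unfolding rev_dickson2_def
    by (rule sum.mono_neutral_left) (auto simp: binomial_eq_0)
  show "rev_dickson2 0 = 1" "rev_dickson2 1 = 1"
    by (simp_all add: rev_dickson2_def)
  define y where "y = (- [:0, 1:] :: int poly)"
  have "rev_dickson2 (n + 2) = (\<Sum>i\<le>Suc n. of_nat ((n + 2 - i) choose i) * y ^ i)"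
    by (simp add: ext y_def)
  also have "\<dots> = 1 + (\<Sum>i\<le>n. of_nat ((n + 1 - i) choose Suc i) * y ^ Suc i)"
    by (simp add: sum.atMost_Suc_shift del: sum.atMost_Suc)
  also have "(\<Sum>i\<le>n. of_nat ((n + 1 - i) choose Suc i) * y ^ Suc i)
      = (\<Sum>i\<le>n. of_nat ((n - i) choose Suc i) * y ^ Suc i)
        + y * (\<Sum>i\<le>n. of_nat ((n - i) choose i) * y ^ i)"
    unfolding sum_distrib_left sum.distrib [symmetric]
    by (rule sum.cong) (auto simp: Suc_diff_le algebra_simps)
  also have "1 + ((\<Sum>i\<le>n. of_nat ((n - i) choose Suc i) * y ^ Suc i)
        + y * (\<Sum>i\<le>n. of_nat ((n - i) choose i) * y ^ i))
      = (\<Sum>i\<le>Suc n. of_nat ((n + 1 - i) choose i) * y ^ i) + y * rev_dickson2 n"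
    by (simp add: sum.atMost_Suc_shift ext y_def del: sum.atMost_Suc)
  finally show "rev_dickson2 (n + 2) = rev_dickson2 (n + 1) - [:0, 1:] * rev_dickson2 n"
    by (simp add: ext y_def)
qed

end

theory Submission imports Defs begin

text \<open>
  Write \<open>e\<^sub>n(x)\<close> for the value of \<open>E\<^sub>n(1,x)\<close> at a point \<open>x\<close> of \<open>F\<^sub>3\<close>. For fixed \<open>x\<close> it satisfies the
  linear recurrence \<open>e\<^sub>n\<^sub>+\<^sub>2 = e\<^sub>n\<^sub>+\<^sub>1 - x e\<^sub>n\<close> with \<open>e\<^sub>0 = e\<^sub>1 = 1\<close>, so as a sequence in \<open>n\<close> it is periodic:

    \<^item> at \<open>x = 0\<close> it is constantly \<open>1\<close>;
    \<^item> at \<open>x = 1\<close> it runs through \<open>1, 1, 0, -1, -1, 0\<close> with period \<open>6\<close>;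
    \<^item> at \<open>x = 2 = -1\<close> it is the Fibonacci sequence \<open>1, 1, 2, 0, 2, 2, 1, 0\<close> modulo \<open>3\<close>, in which
      four steps multiply by \<open>-1\<close>.

  A permutation \<open>f\<close> of \<open>F\<^sub>3\<close> with \<open>f(0) = 1\<close> takes the values \<open>0, 2\<close> at \<open>1, 2\<close> in some order. In the
  order \<open>f(1) = 0\<close>, \<open>f(2) = 2\<close> the function \<open>f(x) + x\<close> is constantly \<open>1\<close>; in the order \<open>f(1) = 2\<close>,
  \<open>f(2) = 0\<close> it takes the values \<open>1, 0, 2\<close>. So \<open>E\<^sub>n\<close> is complete exactly when \<open>e\<^sub>n(1) = 2\<close> and
  \<open>e\<^sub>n(2) = 0\<close> (\<open>bij_with_shift_iff\<close>). By the tables this means \<open>n mod 6 \<in> {3, 4}\<close> and \<open>n mod 4 = 3\<close>,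
  that is, \<open>n\<close> is \<open>3\<close> modulo \<open>12\<close>, which splits into the residues \<open>3\<close> and \<open>15\<close> modulo \<open>24\<close>.
\<close>

lemma cases_mod3:
  fixes x :: 3
  obtains "x = 0" | "x = 1" | "x = 2"
proof (cases x rule: bit1_cases)
  fix z :: int
  assume z: "x = of_int z" "0 \<le> z" "z < int CARD(3)"
  then have "z = 0 \<or> z = 1 \<or> z = 2" by auto
  with z(1) that show thesis by auto
qed

lemma UNIV_mod3: "(UNIV :: 3 set) = {0, 1, 2}"
proof -
  have "x \<in> {0, 1, 2}" for x :: 3
    by (cases x rule: cases_mod3) simp_all
  then show ?thesis by blast
qed

lemma bij_mod3_iff:
  fixes f :: "3 \<Rightarrow> 3"
  shows "bij f \<longleftrightarrow> f 0 \<noteq> f 1 \<and> f 0 \<noteq> f 2 \<and> f 1 \<noteq> f 2"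
proof -
  have "bij f \<longleftrightarrow> inj f"
    by (auto simp: bij_def finite_UNIV_inj_surj)
  also have "\<dots> \<longleftrightarrow> f 0 \<noteq> f 1 \<and> f 0 \<noteq> f 2 \<and> f 1 \<noteq> f 2"
    unfolding UNIV_mod3 by (auto simp: inj_on_def)
  finally show ?thesis .
qed

lemma bij_with_shift_iff:
  fixes f :: "3 \<Rightarrow> 3"
  assumes "f 0 = 1"
  shows "bij f \<and> bij (\<lambda>x. f x + x) \<longleftrightarrow> f 1 = 2 \<and> f 2 = 0"
  unfolding bij_mod3_iff
  by (cases "f 1" rule: cases_mod3; cases "f 2" rule: cases_mod3; simp add: assms)

text \<open>
  Reducing the coefficients and evaluating at \<open>x\<close> together form a ring homomorphism on integer
  polynomials, so the polynomial recurrence becomes a recurrence for the values.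
\<close>

definition rev_dickson2_value :: "'a::comm_ring_1 \<Rightarrow> nat \<Rightarrow> 'a" where
  "rev_dickson2_value x n = poly (map_poly of_int (rev_dickson2 n)) x"

lemma map_poly_of_int_diff:
  "map_poly of_int (p - q) = (map_poly of_int p - map_poly of_int q :: 'a::comm_ring_1 poly)"
  by (rule poly_eqI) (simp add: coeff_map_poly)

lemma rev_dickson2_value_0 [simp]: "rev_dickson2_value x 0 = 1"
  by (simp add: rev_dickson2_value_def rev_dickson2_recurrence)

lemma rev_dickson2_value_1 [simp]: "rev_dickson2_value x (Suc 0) = 1"
  using rev_dickson2_recurrence(2) by (simp add: rev_dickson2_value_def)

lemma rev_dickson2_value_rec:
  "rev_dickson2_value x (Suc (Suc n)) =
     rev_dickson2_value x (Suc n) - x * rev_dickson2_value x n"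
  using rev_dickson2_recurrence(3)[of n]
  by (simp add: rev_dickson2_value_def map_poly_of_int_diff map_poly_pCons)

lemma rev_dickson2_value_at_0: "rev_dickson2_value 0 n = 1"
  by (induction n rule: induct_nat_012) (simp_all add: rev_dickson2_value_rec)

text \<open>
  At \<open>x = 1\<close> the characteristic polynomial \<open>t\<^sup>2 - t + 1\<close> divides \<open>t\<^sup>3 + 1\<close>, over any ring.
\<close>

lemma rev_dickson2_value_at_1_shift:
  "rev_dickson2_value 1 (n + 3) = - rev_dickson2_value 1 n"
  by (simp add: rev_dickson2_value_rec numeral_3_eq_3)

text \<open>
  At \<open>x = 2\<close> the characteristic polynomial \<open>t\<^sup>2 - t - 1\<close> divides \<open>t\<^sup>4 + 1\<close> modulo 3.
\<close>

lemma rev_dickson2_value_at_2_shift: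
  "rev_dickson2_value (2::3) (n + 4) = - rev_dickson2_value 2 n"
  by (cases "rev_dickson2_value (2::3) n" rule: cases_mod3;
      cases "rev_dickson2_value (2::3) (Suc n)" rule: cases_mod3;
      simp add: rev_dickson2_value_rec eval_nat_numeral)

lemma rev_dickson2_value_at_1_eq_2_iff:
  "rev_dickson2_value (1::3) n = 2 \<longleftrightarrow> n mod 6 = 3 \<or> n mod 6 = 4"
proof (induction n rule: less_induct)
  case (less n)
  let ?v = "rev_dickson2_value (1::3)"
  have table: "?v 2 = 0" "?v 3 = 2" "?v 4 = 2" "?v 5 = 0"
    using rev_dickson2_value_rec[of "1::3" 0] rev_dickson2_value_at_1_shift[of 0, where ?'a = 3]
      rev_dickson2_value_at_1_shift[of 1, where ?'a = 3]
      rev_dickson2_value_at_1_shift[of 2, where ?'a = 3]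
    by (simp_all add: numeral_2_eq_2 [symmetric])
  show ?case
  proof (cases "n < 6")
    case True
    then consider "n = 0" | "n = 1" | "n = 2" | "n = 3" | "n = 4" | "n = 5" by linarith
    then show ?thesis
      by cases (simp_all add: table)
  next
    case False
    define m where "m = n - 6"
    have n: "n = m + 3 + 3" using False by (simp add: m_def)
    have "rev_dickson2_value (1::3) n = rev_dickson2_value 1 m"
      unfolding n rev_dickson2_value_at_1_shift by simp
    with less[of m] show ?thesis by (simp add: n)
  qed
qed

lemma rev_dickson2_value_at_2_eq_0_iff:
  "rev_dickson2_value (2::3) n = 0 \<longleftrightarrow> n mod 4 = 3"
proof (induction n rule: less_induct)
  case (less n)
  have table: "rev_dickson2_value (2::3) 2 = 2" "rev_dickson2_value (2::3) 3 = 0"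
    by (simp_all add: numeral_2_eq_2 numeral_3_eq_3 rev_dickson2_value_rec)
  show ?case
  proof (cases "n < 4")
    case True
    then consider "n = 0" | "n = 1" | "n = 2" | "n = 3" by linarith
    then show ?thesis
      by cases (simp_all add: table)
  next
    case False
    define m where "m = n - 4"
    have n: "n = m + 4" using False by (simp add: m_def)
    have "rev_dickson2_value (2::3) n = - rev_dickson2_value 2 m"
      unfolding n by (rule rev_dickson2_value_at_2_shift)
    with less[of m] show ?thesis by (simp add: n)
  qed
qed

theorem theorem4p24:
  fixes n :: nat
  shows "complete_permutation_poly (reduce_mod3 (rev_dickson2 n)) \<longleftrightarrow>
    [n = 3] (mod 24) \<or> [n = 15] (mod 24)"
proof -
  define f where "f = (\<lambda>x::3. rev_dickson2_value x n)"
  have "poly (reduce_mod3 (rev_dickson2 n)) = f"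
    and "poly (reduce_mod3 (rev_dickson2 n) + [:0, 1:]) = (\<lambda>x. f x + x)"
    by (simp_all add: fun_eq_iff f_def reduce_mod3_def rev_dickson2_value_def)
  then have "complete_permutation_poly (reduce_mod3 (rev_dickson2 n)) \<longleftrightarrow>
      bij f \<and> bij (\<lambda>x. f x + x)"
    by (simp add: complete_permutation_poly_def permutation_poly_def)
  also have "\<dots> \<longleftrightarrow> f 1 = 2 \<and> f 2 = 0"
    by (rule bij_with_shift_iff) (simp add: f_def rev_dickson2_value_at_0)
  also have "\<dots> \<longleftrightarrow> (n mod 6 = 3 \<or> n mod 6 = 4) \<and> n mod 4 = 3"
    by (simp add: f_def rev_dickson2_value_at_1_eq_2_iff rev_dickson2_value_at_2_eq_0_iff)
  also have "\<dots> \<longleftrightarrow> n mod 24 = 3 \<or> n mod 24 = 15"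
  proof -
    have "n mod 6 = n mod 24 mod 6" "n mod 4 = n mod 24 mod 4"
      by (simp_all add: mod_mod_cancel)
    moreover have "\<forall>r\<in>{..<24::nat}.
        (r mod 6 = 3 \<or> r mod 6 = 4) \<and> r mod 4 = 3 \<longleftrightarrow> r = 3 \<or> r = 15"
      by code_simp
    moreover have "n mod 24 \<in> {..<24}" by simp
    ultimately show ?thesis by metis
  qed
  also have "\<dots> \<longleftrightarrow> [n = 3] (mod 24) \<or> [n = 15] (mod 24)"
    by (simp add: cong_def)
  finally show ?thesis .
qed

end
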